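(* Let $g\colon\mathbb{C}\to\mathbb{C}$ be a function obtained by the construction described in the context, let $L$ be its Lipschitz constant, let $0<\epsilon<1/(2L)$, and let $$f(z)=z+\epsilon\sum_{m=0}^\infty 4^{-m}g(4^mz),\qquad z\in\mathbb{C}.$$ Then for every $q$ with $0\le q<1/2$ the mapping $f$ does not have finite $\phi$-variation on lines, where $$\phi(t)=\frac{t}{(\log(e+1/t))^q}\ \text{ if } t>0,\qquad \phi(0)=0.$$
   Context: Construction of $g$: let $Q=\{x+iy\colon 2<x<6,\ |y|<2\}$, $Q_1=\{x+iy\colon|x-3|+|y|\le1\}$, $Q_2=\{x+iy\colon|x-5|+|y|\le1\}$. Let $g\colon\overline{Q}\to\mathbb{C}$ be a Lipschitz function such that $g(z)=i(z-2)$ for $z\in Q_1$, $g(z)=i(6-z)$ for $z\in Q_2$, and $g(z)=0$ for $z\in\partial Q$. Extend $g$ to $A=\bigcup_{k\in\mathbb{Z}}(\overline{Q}+8k)$ so that $g(z+8)=g(z)$, and set $g(z)=0$ for $z\notin A$. For convex strictly increasing $\phi\colon[0,\infty)\to[0,\infty)$ with $\phi(0)=0$, and distinct points $a,b$, a partition $0=t_0<t_1<\dots<t_N=1$ induces the partition $a_j=a+t_j(b-a)$, $j=0,\dots,N$, of the closed line segment $[a,b]$. A mapping $f$ on $[a,b]$ has finite $\phi$-variation on $[a,b]$ if $\sup\sum_{j=1}^N\phi(|f(a_j)-f(a_{j-1})|)<\infty$, the supremum being over all $N\ge1$ and all partitions $(a_j)_{j=0}^N$ of $[a,b]$. A mapping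 on a domain $\Omega$ has finite $\phi$-variation on lines if its restriction to every compact line segment contained in $\Omega$ has finite $\phi$-variation. *)

theory Defs
  imports "HOL-Analysis.Analysis"
begin

definition boxQ :: "complex set" where
  "boxQ = {z. 2 < Re z \<and> Re z < 6 \<and> \<bar>Im z\<bar> < 2}"

definition diamond1 :: "complex set" where
  "diamond1 = {z. \<bar>Re z - 3\<bar> + \<bar>Im z\<bar> \<le> 1}"

definition diamond2 :: "complex set" where
  "diamond2 = {z. \<bar>Re z - 5\<bar> + \<bar>Im z\<bar> \<le> 1}"

definition translatesA :: "complex set" where
  "translatesA = (\<Union>k::int. (\<lambda>z. z + 8 * of_int k) ` closure boxQ)"

text \<open>The construction leaves a choice of Lipschitz function on the closed box, so it is
  rendered as a predicate satisfied by every function that it can produce.\<close>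

definition constructed :: "(complex \<Rightarrow> complex) \<Rightarrow> bool" where
  "constructed g \<longleftrightarrow>
     (\<exists>C. C-lipschitz_on (closure boxQ) g) \<and>
     (\<forall>z\<in>diamond1. g z = \<i> * (z - 2)) \<and>
     (\<forall>z\<in>diamond2. g z = \<i> * (6 - z)) \<and>
     (\<forall>z\<in>frontier boxQ. g z = 0) \<and>
     (\<forall>z\<in>translatesA. g (z + 8) = g z) \<and>
     (\<forall>z. z \<notin> translatesA \<longrightarrow> g z = 0)"

text \<open>The least Lipschitz constant; only meaningful for Lipschitz functions.\<close>

definition lipschitz_constant :: "('a::metric_space \<Rightarrow> 'b::metric_space) \<Rightarrow> real" where
  "lipschitz_constant g = Inf {C. C-lipschitz_on UNIV g}"

definition unit_partition :: "nat \<Rightarrow> (nat \<Rightarrow> real) \<Rightarrow> bool" where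
  "unit_partition N t \<longleftrightarrow> N \<ge> 1 \<and> t 0 = 0 \<and> t N = 1 \<and> (\<forall>j<N. t j < t (Suc j))"

definition partition_point :: "complex \<Rightarrow> complex \<Rightarrow> (nat \<Rightarrow> real) \<Rightarrow> nat \<Rightarrow> complex" where
  "partition_point a b t j = a + of_real (t j) * (b - a)"

definition phi_variation_sum ::
  "(real \<Rightarrow> real) \<Rightarrow> (complex \<Rightarrow> complex) \<Rightarrow> complex \<Rightarrow> complex \<Rightarrow> nat \<Rightarrow> (nat \<Rightarrow> real) \<Rightarrow> real" where
  "phi_variation_sum \<phi> f a b N t =
     (\<Sum>j=1..N. \<phi> (cmod (f (partition_point a b t j) - f (partition_point a b t (j - 1)))))"

definition finite_phi_variation_on_segment ::
  "(real \<Rightarrow> real) \<Rightarrow> (complex \<Rightarrow> complex) \<Rightarrow> complex \<Rightarrow> complex \<Rightarrow> bool" where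
  "finite_phi_variation_on_segment \<phi> f a b \<longleftrightarrow>
     bdd_above {phi_variation_sum \<phi> f a b N t | N t. unit_partition N t}"

definition finite_phi_variation_on_lines ::
  "(real \<Rightarrow> real) \<Rightarrow> complex set \<Rightarrow> (complex \<Rightarrow> complex) \<Rightarrow> bool" where
  "finite_phi_variation_on_lines \<phi> \<Omega> f \<longleftrightarrow>
     (\<forall>a b. a \<noteq> b \<and> closed_segment a b \<subseteq> \<Omega> \<longrightarrow> finite_phi_variation_on_segment \<phi> f a b)"

definition log_phi :: "real \<Rightarrow> real \<Rightarrow> real" where
  "log_phi q t = (if t > 0 then t / (ln (exp 1 + 1 / t)) powr q else 0)"

text \<open>The variation above is considered only for gauges in the following class. It is not a
  conjunct of the variation predicates, whose negation would then hold for all other gauges;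
  instead, the gauges used here are shown to belong to the class.\<close>

definition variation_gauge :: "(real \<Rightarrow> real) \<Rightarrow> bool" where
  "variation_gauge \<phi> \<longleftrightarrow>
     convex_on {0..} \<phi> \<and> strict_mono_on {0..} \<phi> \<and> \<phi> 0 = 0 \<and> (\<forall>t\<ge>0. \<phi> t \<ge> 0)"

lemma log_ge_one: "u \<ge> 0 \<Longrightarrow> ln (exp 1 + u) \<ge> (1::real)"
  by (subst ln_ge_iff) (auto intro: add_pos_nonneg)

lemma log_powr_antimono:
  fixes q :: real
  assumes "q \<ge> 0" "0 \<le> u" "u \<le> v"
  shows "ln (exp 1 + v) powr (-q) \<le> ln (exp 1 + u) powr (-q)"
proof -
  have "ln (exp 1 + u) \<le> ln (exp 1 + v)"
    using assms by (subst ln_le_cancel_iff) (auto intro: add_pos_nonneg)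
  then show ?thesis
    using assms log_ge_one[of u] by (intro powr_mono2') auto
qed

lemma log_phi_pos: "t > 0 \<Longrightarrow> log_phi q t = t * ln (exp 1 + 1 / t) powr (-q)"
  by (simp add: log_phi_def powr_minus divide_inverse)

lemma log_phi_scale:
  assumes "q \<ge> 0" "0 \<le> c" "c \<le> 1" "t \<ge> 0"
  shows "log_phi q (c * t) \<le> c * log_phi q t"
proof (cases "c = 0 \<or> t = 0")
  case False
  then have p: "c > 0" "t > 0" using assms by auto
  have "1 / t \<le> 1 / (c * t)"
    using p assms by (simp add: field_simps)
  then have "ln (exp 1 + 1 / (c * t)) powr (-q) \<le> ln (exp 1 + 1 / t) powr (-q)"
    using p assms by (intro log_powr_antimono) auto
  then show ?thesis
    using p by (simp add: log_phi_pos mult.assoc mult_left_mono)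
qed (auto simp: log_phi_def)

lemma powr_neg_convex:
  fixes q :: real
  assumes "q \<ge> 0"
  shows "convex_on {0<..} (\<lambda>x. x powr (-q))"
proof (rule f''_ge0_imp_convex)
  show "convex {0::real<..}" by simp
  show "((\<lambda>x. x powr (-q)) has_real_derivative (-q) * x powr (-q-1)) (at x)"
    if "x \<in> {0<..}" for x
    using that by (auto intro!: derivative_eq_intros)
  show "((\<lambda>x. (-q) * x powr (-q-1)) has_real_derivative (-q) * ((-q-1) * x powr (-q-2))) (at x)"
    if "x \<in> {0<..}" for x
    using that by (auto intro!: derivative_eq_intros simp: algebra_simps)
  show "(-q) * ((-q-1) * x powr (-q-2)) \<ge> 0" if "x \<in> {0<..}" for x
    using assms by (intro mult_nonpos_nonpos mult_nonpos_nonneg) auto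
qed

lemma log_powr_convex:
  fixes q :: real
  assumes q: "q \<ge> 0" and u: "u \<ge> 0" "v \<ge> 0" and c: "c \<ge> 0" "d \<ge> 0" "c + d = 1"
  shows "ln (exp 1 + (c * u + d * v)) powr (-q)
           \<le> c * ln (exp 1 + u) powr (-q) + d * ln (exp 1 + v) powr (-q)"
proof -
  have pos: "exp 1 + u > 0" "exp 1 + v > 0" using u by (auto intro: add_pos_nonneg)
  have eq: "exp 1 + (c * u + d * v) = c * (exp 1 + u) + d * (exp 1 + v)"
  proof -
    have "c * (exp 1 + u) + d * (exp 1 + v) = (c + d) * exp 1 + (c * u + d * v)"
      by (simp add: algebra_simps)
    then show ?thesis using c by simp
  qed
  have lge: "c * ln (exp 1 + u) + d * ln (exp 1 + v) \<le> ln (exp 1 + (c * u + d * v))"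
  proof -
    have cd: "1 - d = c" using c by simp
    show ?thesis
      unfolding eq using concave_onD[OF ln_concave, of d "exp 1 + u" "exp 1 + v", unfolded cd] c pos by simp
  qed
  have p1: "c * 1 + d * 1 \<le> c * ln (exp 1 + u) + d * ln (exp 1 + v)"
    using c u by (intro add_mono mult_left_mono log_ge_one) auto
  have "ln (exp 1 + (c * u + d * v)) powr (-q) \<le> (c * ln (exp 1 + u) + d * ln (exp 1 + v)) powr (-q)"
    using lge p1 c q by (intro powr_mono2') auto
  also have "\<dots> \<le> c * ln (exp 1 + u) powr (-q) + d * ln (exp 1 + v) powr (-q)"
  proof -
    have cd: "1 - d = c" using c by simp
    show ?thesis
      using convex_onD[OF powr_neg_convex[OF q], of d "ln (exp 1 + u)" "ln (exp 1 + v)", unfolded cd]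
        c log_ge_one[OF u(1)] log_ge_one[OF u(2)] by simp
  qed
  finally show ?thesis .
qed

lemma log_phi_convex_pos:
  assumes q: "q \<ge> 0" and st: "s > 0" "t > 0" and c: "c > 0" "d > 0" "c + d = 1"
  shows "log_phi q (c * s + d * t) \<le> c * log_phi q s + d * log_phi q t"
proof -
  define T where "T = c * s + d * t"
  have T: "T > 0" unfolding T_def using st c by (simp add: add_pos_pos)
  have 1: "c * s / T + d * t / T = 1"
    using T by (simp add: T_def add_divide_distrib[symmetric])
  have 2: "c * s / T * (1 / s) + d * t / T * (1 / t) = 1 / T"
    using st c(3) by (simp add: add_divide_distrib[symmetric])
  have "T * ln (exp 1 + 1 / T) powr (-q)
      \<le> T * (c * s / T * ln (exp 1 + 1 / s) powr (-q) + d * t / T * ln (exp 1 + 1 / t) powr (-q))"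
    using log_powr_convex[OF q, of "1 / s" "1 / t" "c * s / T" "d * t / T"] st c T 1
    unfolding 2 by (intro mult_left_mono) auto
  also have "\<dots> = c * log_phi q s + d * log_phi q t"
    using T st by (simp add: log_phi_pos field_simps)
  finally show ?thesis using T by (simp add: log_phi_pos T_def[symmetric])
qed

lemma variation_gauge_log_phi:
  assumes q: "q \<ge> 0"
  shows "variation_gauge (log_phi q)"
  unfolding variation_gauge_def
proof (intro conjI allI impI)
  show "convex_on {0..} (log_phi q)"
  proof (rule convex_onI)
    fix d s t :: real
    assume *: "0 < d" "d < 1" "s \<in> {0..}" "t \<in> {0..}"
    consider "s = 0" | "t = 0" | "s > 0" "t > 0" using * by fastforce
    then show "log_phi q ((1 - d) *\<^sub>R s + d *\<^sub>R t) \<le> (1 - d) * log_phi q s + d * log_phi q t"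
    proof cases
      case 1 then show ?thesis
        using log_phi_scale[OF q, of d t] * by (simp add: log_phi_def)
    next
      case 2 then show ?thesis
        using log_phi_scale[OF q, of "1 - d" s] * by (simp add: log_phi_def)
    next
      case 3 then show ?thesis
        using log_phi_convex_pos[OF q, of s t "1 - d" d] * by simp
    qed
  qed simp
  show "strict_mono_on {0..} (log_phi q)"
  proof (rule strict_mono_onI)
    fix s t :: real
    assume *: "s \<in> {0..}" "t \<in> {0..}" "s < t"
    have h: "ln (exp 1 + 1 / t) powr (-q) > 0"
      using log_ge_one[of "1 / t"] * by simp
    have "log_phi q s \<le> s * ln (exp 1 + 1 / t) powr (-q)"
      using log_phi_scale[OF q, of "s / t" t] * by (simp add: log_phi_pos)
    also have "\<dots> < log_phi q t" using * h by (simp add: log_phi_pos)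
    finally show "log_phi q s < log_phi q t" .
  qed
qed (auto simp: log_phi_def)

end

theory Submission
  imports Defs "HOL-Real_Asymp.Real_Asymp"
begin

text \<open>
  The variation is already infinite on the segment from 0 to 8 of the real axis. There \<open>g\<close> is \<open>\<i>\<close>
  times an 8-periodic tent function that is linear on each interval between consecutive even
  integers, with slopes 0, 1, -1, 0 over one period. Writing \<open>x = 2 y\<close>, the slope of
  \<open>g (4 ^ m * x) / 4 ^ m\<close> is therefore a function of a single base-4 digit of \<open>y\<close>, and on an interval
  of length \<open>2 / 4 ^ n\<close> of the grid \<open>2 j / 4 ^ n\<close> the series has slope \<open>\<i>\<close> times the sum of \<open>n + 1\<close>
  such digit contributions: the terms with \<open>m > n\<close> vanish at all grid points. When the interval
  varies over the \<open>4 ^ (n + 1)\<close> intervals of the grid, the digits are independent and uniform, so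
  this slope is a lazy simple random walk after \<open>n + 1\<close> steps.

  The typical size of the walk after \<open>N\<close> steps is \<open>sqrt N\<close>; the lower bound for the mean of its
  absolute value (\<open>sum_abs_walk\<close>) comes from its second and fourth moments. On the other hand every
  increment of \<open>f\<close> over the grid has modulus at least \<open>2 / 4 ^ n\<close>, as the real part of \<open>f\<close> is the
  identity on the real axis, so the logarithm in \<open>log_phi\<close> is at most \<open>2 N\<close> for \<open>N = n + 1\<close>. The
  variation sum over the grid is thus at least \<open>\<epsilon> * sqrt N / (2 * N) powr q\<close>, which is unbounded
  because \<open>q < 1/2\<close>.
\<close>

section \<open>A lazy random walk on base-4 digits\<close>

text \<open>The slope of the tent function on the interval between \<open>2 d\<close> and \<open>2 d + 2\<close>.\<close>

definition digit_slope :: "nat \<Rightarrow> real" where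
  "digit_slope d = (if d mod 4 = 1 then 1 else if d mod 4 = 2 then -1 else 0)"

definition walk :: "nat \<Rightarrow> nat \<Rightarrow> real" where
  "walk n j = (\<Sum>k<n. digit_slope (j div 4 ^ k))"

lemma walk_Suc: "walk (Suc n) j = walk n (j div 4) + digit_slope j"
  unfolding walk_def
  by (subst sum.lessThan_Suc_shift) (simp add: div_mult2_eq)

lemma sum_blocks_of_four:
  fixes G :: "nat \<Rightarrow> 'a::comm_monoid_add"
  shows "(\<Sum>j<4 * M. G j) = (\<Sum>i<M. G (4*i) + G (4*i+1) + G (4*i+2) + G (4*i+3))"
proof (induction M)
  case (Suc M)
  have "4 * Suc M = Suc (Suc (Suc (Suc (4 * M))))" by simp
  then show ?case
    using Suc by (simp add: add.assoc numeral_eq_Suc)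
qed simp

text \<open>The last digit is uniform and independent of the others, so a step is 1 or -1 with
  probability 1/4 each and 0 with probability 1/2. All moments of the walk follow from this
  by choosing \<open>F\<close>.\<close>

lemma sum_walk_Suc:
  fixes F :: "real \<Rightarrow> real"
  shows "(\<Sum>j<4 ^ Suc n. F (walk (Suc n) j)) =
    (\<Sum>i<4 ^ n. 2 * F (walk n i) + F (walk n i + 1) + F (walk n i - 1))"
proof -
  have d: "Suc (4*i) div 4 = i" "(4*i+2) div 4 = i" "(4*i+3) div 4 = i"
    "Suc (4*i) mod 4 = 1" "(4*i+2) mod 4 = 2" "(4*i+3) mod 4 = 3" for i :: nat
    by presburger+
  show ?thesis
    unfolding power_Suc sum_blocks_of_four walk_Suc
    by (intro sum.cong refl) (simp add: d digit_slope_def del: add_2_eq_Suc')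
qed

lemma sum_walk_square: "(\<Sum>j<4 ^ n. (walk n j)\<^sup>2) = 4 ^ n * (real n / 2)"
proof (induction n)
  case (Suc n)
  have "(\<Sum>j<4 ^ Suc n. (walk (Suc n) j)\<^sup>2) = (\<Sum>i<4 ^ n. 4 * (walk n i)\<^sup>2 + 2)"
    by (subst sum_walk_Suc[where F = "\<lambda>x. x\<^sup>2"])
      (intro sum.cong refl, simp add: power2_eq_square algebra_simps)
  also have "\<dots> = 4 * (\<Sum>i<4 ^ n. (walk n i)\<^sup>2) + 2 * 4 ^ n"
    by (simp add: sum.distrib sum_distrib_left)
  finally show ?case using Suc by (simp add: algebra_simps)
qed (simp add: walk_def)

lemma sum_walk_fourth: "(\<Sum>j<4 ^ n. walk n j ^ 4) \<le> 4 ^ n * (real n)\<^sup>2"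
proof (induction n)
  case (Suc n)
  have "(\<Sum>j<4 ^ Suc n. walk (Suc n) j ^ 4)
      = (\<Sum>i<4 ^ n. 4 * walk n i ^ 4 + 12 * (walk n i)\<^sup>2 + 2)"
    by (subst sum_walk_Suc[where F = "\<lambda>x. x ^ 4"])
      (intro sum.cong refl, simp add: power2_eq_square power4_eq_xxxx algebra_simps)
  also have "\<dots> = 4 * (\<Sum>i<4 ^ n. walk n i ^ 4) + 12 * (\<Sum>i<4 ^ n. (walk n i)\<^sup>2) + 2 * 4 ^ n"
    by (simp add: sum.distrib sum_distrib_left)
  also have "\<dots> \<le> 4 * (4 ^ n * (real n)\<^sup>2) + 12 * (4 ^ n * (real n / 2)) + 4 * 4 ^ n"
    unfolding sum_walk_square by (intro add_mono mult_left_mono order_refl Suc.IH) auto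
  also have "\<dots> \<le> 4 ^ Suc n * (real (Suc n))\<^sup>2"
    by (simp add: power2_eq_square algebra_simps)
  finally show ?case .
qed (simp add: walk_def)

text \<open>A lower bound for the first absolute moment in terms of the second and fourth: with
  \<open>u = \<bar>x\<bar> / a\<close> it is the inequality \<open>u\<^sup>2 - u ^ 4 \<le> u\<close>.\<close>

lemma abs_ge_moments:
  fixes x a :: real
  assumes "a > 0"
  shows "\<bar>x\<bar> \<ge> x\<^sup>2 / a - x ^ 4 / a ^ 3"
proof -
  define u where "u = \<bar>x\<bar> / a"
  have u: "u \<ge> 0" using assms by (simp add: u_def)
  have "u\<^sup>2 - u ^ 4 \<le> u"
  proof (cases "u \<le> 1")
    case True
    then have "u * u \<le> 1 * u" using u by (intro mult_right_mono)
    moreover have "u ^ 4 \<ge> 0" by simp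
    ultimately show ?thesis unfolding power2_eq_square by linarith
  next
    case False
    then have "u\<^sup>2 \<le> u ^ 4" by (intro power_increasing) auto
    then show ?thesis using u by linarith
  qed
  then have "a * (u\<^sup>2 - u ^ 4) \<le> a * u" using assms by (intro mult_left_mono) auto
  moreover have "a * u\<^sup>2 = x\<^sup>2 / a"
    using assms by (simp add: u_def power_divide power2_eq_square)
  moreover have "a * u ^ 4 = x ^ 4 / a ^ 3"
    using assms by (simp add: u_def power_divide eval_nat_numeral)
  moreover have "a * u = \<bar>x\<bar>" using assms by (simp add: u_def)
  ultimately show ?thesis by (simp add: right_diff_distrib)
qed

lemma sum_abs_walk:
  assumes "n > 0"
  shows "(\<Sum>j<4 ^ n. \<bar>walk n j\<bar>) \<ge> 4 ^ n * sqrt n / 8"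
proof -
  \<comment> \<open>A scale of the order of the standard deviation; the factor 2 makes the second moment dominate.\<close>
  define a where "a = 2 * sqrt (real n)"
  have a: "a > 0" "a\<^sup>2 = 4 * real n"
    using assms by (auto simp: a_def power_mult_distrib)
  have "4 ^ n * sqrt n / 8 = 4 ^ n * (a / 16)" by (simp add: a_def)
  also have "a / 16 = (real n / 2) / a - (real n)\<^sup>2 / a ^ 3"
  proof -
    have n: "real n = a\<^sup>2 / 4" using a by simp
    show ?thesis unfolding n using a(1) by (simp add: field_simps eval_nat_numeral)
  qed
  also have "4 ^ n * \<dots> = 4 ^ n * (real n / 2) / a - 4 ^ n * (real n)\<^sup>2 / a ^ 3"
    by (simp add: algebra_simps)
  also have "\<dots> \<le> (\<Sum>j<4 ^ n. (walk n j)\<^sup>2) / a - (\<Sum>j<4 ^ n. walk n j ^ 4) / a ^ 3"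
    unfolding sum_walk_square using a(1)
    by (intro diff_mono divide_right_mono sum_walk_fourth) auto
  also have "\<dots> = (\<Sum>j<4 ^ n. (walk n j)\<^sup>2 / a - walk n j ^ 4 / a ^ 3)"
    by (simp add: sum_subtractf sum_divide_distrib)
  also have "\<dots> \<le> (\<Sum>j<4 ^ n. \<bar>walk n j\<bar>)"
    using a(1) by (intro sum_mono abs_ge_moments)
  finally show ?thesis .
qed

section \<open>The constructed function on the real axis\<close>

lemma closure_boxQ: "closure boxQ = {z. 2 \<le> Re z \<and> Re z \<le> 6 \<and> \<bar>Im z\<bar> \<le> 2}"
proof -
  have b: "boxQ = box (Complex 2 (-2)) (Complex 6 2)"
    by (auto simp: boxQ_def in_box_complex_iff)
  have "4 \<in> box (Complex 2 (-2)) (Complex 6 2)"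
    by (simp add: in_box_complex_iff)
  then have "box (Complex 2 (-2)) (Complex 6 2) \<noteq> {}" by blast
  then show ?thesis
    unfolding b by (auto simp: closure_box in_cbox_complex_iff)
qed

lemma constructed_periodic:
  assumes "constructed g" and "z \<in> closure boxQ"
  shows "g (z + 8 * of_nat k) = g z"
proof (induction k)
  case (Suc k)
  have "z + 8 * of_nat k \<in> (\<lambda>z. z + 8 * of_int (int k)) ` closure boxQ"
    using assms(2) by auto
  then have "z + 8 * of_nat k \<in> translatesA"
    unfolding translatesA_def by blast
  then have "g (z + 8 * of_nat k + 8) = g (z + 8 * of_nat k)"
    using assms(1) by (simp add: constructed_def)
  then show ?case using Suc by (simp add: algebra_simps)
qed simp

lemma real_in_translatesA:
  fixes x :: real
  assumes "of_real x \<in> translatesA"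
  obtains k :: int where "8 * k + 2 \<le> x" "x \<le> 8 * k + 6"
proof -
  obtain k :: int and z where "z \<in> closure boxQ" "of_real x = z + 8 * of_int k"
    using assms by (auto simp: translatesA_def)
  then have "x = Re z + 8 * k" "2 \<le> Re z" "Re z \<le> 6"
    by (auto simp: closure_boxQ complex_eq_iff)
  then show ?thesis by (intro that[of k]) auto
qed

text \<open>On the real axis the function is determined by the construction, whatever Lipschitz function
  was chosen on the box: the intersection of the closed box with the axis is covered by the two
  diamonds.\<close>

lemma constructed_on_period:
  assumes g: "constructed g" and r: "0 \<le> r" "r \<le> 8"
  shows "g (of_real (8 * real k + r)) = \<i> * of_real (max 0 (2 - \<bar>r - 4\<bar>))"
proof (cases "2 \<le> r \<and> r \<le> 6")
  case True
  have "g (of_real (8 * real k + r)) = g (of_real r)"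
    using constructed_periodic[OF g, of "of_real r" k] True
    by (simp add: closure_boxQ add.commute)
  also have "\<dots> = \<i> * of_real (max 0 (2 - \<bar>r - 4\<bar>))"
  proof (cases "r \<le> 4")
    case True
    then have "of_real r \<in> diamond1"
      using \<open>2 \<le> r \<and> r \<le> 6\<close> by (auto simp: diamond1_def)
    then show ?thesis
      using g True \<open>2 \<le> r \<and> r \<le> 6\<close> by (auto simp: constructed_def max_def complex_eq_iff)
  next
    case False
    then have "of_real r \<in> diamond2"
      using \<open>2 \<le> r \<and> r \<le> 6\<close> by (auto simp: diamond2_def)
    then show ?thesis
      using g False \<open>2 \<le> r \<and> r \<le> 6\<close> by (auto simp: constructed_def max_def complex_eq_iff)
  qed
  finally show ?thesis .
next
  case False
  have "of_real (8 * real k + r) \<notin> translatesA"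
  proof
    assume "of_real (8 * real k + r) \<in> translatesA"
    then obtain l :: int where "8 * l + 2 \<le> 8 * real k + r" "8 * real k + r \<le> 8 * l + 6"
      by (rule real_in_translatesA)
    then have "of_int (8 * l + 2) \<le> real_of_int (8 * int k + 8)"
      "real_of_int (8 * int k) \<le> of_int (8 * l + 6)"
      using r by simp_all
    then have "l = int k" unfolding of_int_le_iff by linarith
    then show False
      using False \<open>8 * l + 2 \<le> 8 * real k + r\<close> \<open>8 * real k + r \<le> 8 * l + 6\<close> by auto
  qed
  then have "g (of_real (8 * real k + r)) = 0"
    using g unfolding constructed_def by blast
  then show ?thesis using False by (auto simp: max_def)
qed

text \<open>The closed range of \<open>t\<close> allows both end points of a linear piece to be computed with the same
  index \<open>d\<close>.\<close>

lemma constructed_linear_piece: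
  assumes g: "constructed g" and t: "0 \<le> t" "t \<le> 1"
  shows "g (of_real (2 * (real d + t)))
    = 2 * \<i> * of_real ((if d mod 4 = 2 then 1 else 0) + digit_slope d * t)"
proof -
  define r where "r = 2 * (real (d mod 4) + t)"
  have c: "d mod 4 \<in> {0, 1, 2, 3}" by auto
  have r: "0 \<le> r" "r \<le> 8" using c t by (auto simp: r_def)
  have "real d = 4 * real (d div 4) + real (d mod 4)"
    by (metis of_nat_add of_nat_mult of_nat_numeral mult_div_mod_eq)
  then have "2 * (real d + t) = 8 * real (d div 4) + r"
    by (simp add: r_def)
  then have "g (of_real (2 * (real d + t))) = \<i> * of_real (max 0 (2 - \<bar>r - 4\<bar>))"
    using constructed_on_period[OF g r] by simp
  also have "max 0 (2 - \<bar>r - 4\<bar>) = 2 * ((if d mod 4 = 2 then 1 else 0) + digit_slope d * t)"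
    using c t by (auto simp: r_def digit_slope_def max_def)
  finally show ?thesis by simp
qed

lemma constructed_increment:
  assumes g: "constructed g" and "M > 0"
  shows "g (of_real (2 * real (Suc j) / real M)) - g (of_real (2 * real j / real M))
    = 2 * \<i> * of_real (digit_slope (j div M) / real M)"
proof -
  define d t where "d = j div M" and "t = real (j mod M) / real M"
  have jM: "real j = real d * real M + real (j mod M)"
    unfolding d_def by (metis div_mult_mod_eq of_nat_add of_nat_mult)
  have "Suc (j mod M) \<le> M" using assms by (simp add: Suc_le_eq)
  then have m: "real (j mod M) + 1 \<le> real M" by linarith
  have t: "0 \<le> t" "t + 1 / real M \<le> 1"
    using m assms by (auto simp: t_def add_divide_distrib[symmetric])
  moreover have "0 \<le> 1 / real M" by simp
  ultimately have "t \<le> 1" "0 \<le> t + 1 / real M" by linarith+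
  note G = constructed_linear_piece[OF g t(1) this(1), of d]
    constructed_linear_piece[OF g this(2) t(2), of d]
  have e: "2 * real j / real M = 2 * (real d + t)"
    "2 * real (Suc j) / real M = 2 * (real d + (t + 1 / real M))"
    using assms jM by (auto simp: t_def field_simps)
  show ?thesis
    unfolding e G unfolding d_def by (simp add: algebra_simps)
qed

section \<open>Increments over the grid and divergence\<close>

text \<open>On the grid of mesh \<open>2 / 4 ^ n\<close> the series is a finite sum, as \<open>4 ^ m\<close> maps the grid into the
  zeros \<open>8 k\<close> of \<open>g\<close> for \<open>m > n\<close>.\<close>

lemma series_on_grid:
  assumes g: "constructed g"
  shows "(\<Sum>m. g (4 ^ m * of_real (2 * real j / 4 ^ n)) / 4 ^ m)
    = (\<Sum>m\<le>n. g (4 ^ m * of_real (2 * real j / 4 ^ n)) / 4 ^ m)"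
proof (rule suminf_finite)
  fix m assume "m \<notin> {..n}"
  then obtain k where m: "m = Suc (n + k)"
    by (metis atMost_iff less_iff_Suc_add not_le)
  have "4 ^ m * complex_of_real (2 * real j / 4 ^ n) = of_real (8 * real (4 ^ k * j) + 0)"
    by (simp add: m power_add)
  then show "g (4 ^ m * of_real (2 * real j / 4 ^ n)) / 4 ^ m = 0"
    using constructed_on_period[OF g, of 0 "4 ^ k * j"] by simp
qed simp

lemma grid_increment:
  assumes g: "constructed g"
    and f: "\<And>z. f z = z + of_real \<epsilon> * (\<Sum>m. g (4 ^ m * z) / 4 ^ m)"
  shows "f (of_real (2 * real (Suc j) / 4 ^ n)) - f (of_real (2 * real j / 4 ^ n))
    = of_real (2 / 4 ^ n) * Complex 1 (\<epsilon> * walk (Suc n) j)"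
proof -
  define P where "P i = complex_of_real (2 * real i / 4 ^ n)" for i :: nat
  have inc: "g (4 ^ m * P (Suc j)) / 4 ^ m - g (4 ^ m * P j) / 4 ^ m
      = of_real (2 / 4 ^ n) * \<i> * of_real (digit_slope (j div 4 ^ (n - m)))" if "m \<le> n" for m
  proof -
    have n: "(4::real) ^ n = 4 ^ m * 4 ^ (n - m)"
      using that by (simp flip: power_add)
    then have e: "4 ^ m * P i = of_real (2 * real i / real (4 ^ (n - m)))" for i
      by (simp add: P_def)
    have "g (4 ^ m * P (Suc j)) - g (4 ^ m * P j)
        = 2 * \<i> * of_real (digit_slope (j div 4 ^ (n - m)) / real (4 ^ (n - m)))"
      unfolding e by (rule constructed_increment[OF g]) simp
    then show ?thesis
      unfolding n by (simp add: mult_ac flip: diff_divide_distrib)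
  qed
  have rev: "(\<Sum>m\<le>n. digit_slope (j div 4 ^ (n - m))) = walk (Suc n) j"
    unfolding walk_def lessThan_Suc_atMost
    using sum.nat_diff_reindex[of "\<lambda>k. digit_slope (j div 4 ^ k)" "Suc n"]
    by (simp add: lessThan_Suc_atMost)
  have S: "(\<Sum>m. g (4 ^ m * P i) / 4 ^ m) = (\<Sum>m\<le>n. g (4 ^ m * P i) / 4 ^ m)" for i
    unfolding P_def by (rule series_on_grid[OF g])
  have "f (P (Suc j)) - f (P j)
      = P (Suc j) - P j + of_real \<epsilon> * (\<Sum>m\<le>n. g (4 ^ m * P (Suc j)) / 4 ^ m - g (4 ^ m * P j) / 4 ^ m)"
    unfolding f S by (simp add: sum_subtractf algebra_simps)
  also have "(\<Sum>m\<le>n. g (4 ^ m * P (Suc j)) / 4 ^ m - g (4 ^ m * P j) / 4 ^ m)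
      = of_real (2 / 4 ^ n) * \<i> * of_real (walk (Suc n) j)"
    unfolding rev[symmetric] of_real_sum sum_distrib_left by (intro sum.cong refl inc) simp
  also have "P (Suc j) - P j = of_real (2 / 4 ^ n)"
    by (simp add: P_def field_simps)
  also have "of_real (2 / 4 ^ n) + of_real \<epsilon> * (of_real (2 / 4 ^ n) * \<i> * of_real (walk (Suc n) j))
      = of_real (2 / 4 ^ n) * Complex 1 (\<epsilon> * walk (Suc n) j)"
    by (simp add: Complex_eq algebra_simps)
  finally show ?thesis by (simp add: P_def)
qed

text \<open>The real part of an increment keeps it away from 0, which bounds the logarithm in the gauge;
  its imaginary part makes it large.\<close>

lemma log_phi_grid_increment:
  assumes "q \<ge> 0" and "\<epsilon> > 0"
  shows "log_phi q (cmod (of_real (2 / 4 ^ n) * Complex 1 (\<epsilon> * w)))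
    \<ge> 2 / 4 ^ n * (\<epsilon> * \<bar>w\<bar>) * (2 * real (Suc n)) powr (-q)"
proof -
  define c where "c = cmod (Complex 1 (\<epsilon> * w))"
  define \<tau> where "\<tau> = 2 / 4 ^ n * c"
  have c: "1 \<le> c" "\<epsilon> * \<bar>w\<bar> \<le> c"
    using abs_Re_le_cmod[of "Complex 1 (\<epsilon> * w)"] abs_Im_le_cmod[of "Complex 1 (\<epsilon> * w)"] assms
    by (auto simp: c_def abs_mult)
  have \<tau>: "cmod (of_real (2 / 4 ^ n) * Complex 1 (\<epsilon> * w)) = \<tau>"
    by (simp add: \<tau>_def c_def norm_mult norm_divide norm_power)
  have pos: "\<tau> > 0" using c by (simp add: \<tau>_def)
  have "1 / \<tau> = 4 ^ n / 2 / c" using c by (simp add: \<tau>_def)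
  also have "\<dots> \<le> 4 ^ n / 2 / 1" using c by (intro divide_left_mono) auto
  finally have "1 / \<tau> \<le> 4 ^ n / 2" by simp
  moreover have "exp 1 \<le> (3::real)" by (rule exp_le)
  moreover have "(1::real) \<le> 4 ^ n" by simp
  ultimately have "exp 1 + 1 / \<tau> \<le> 4 ^ Suc n" unfolding power_Suc by linarith
  moreover have "exp 1 + 1 / \<tau> > 0" using pos by (simp add: add_pos_pos)
  ultimately have "ln (exp 1 + 1 / \<tau>) \<le> ln (4 ^ Suc n)"
    by (subst ln_le_cancel_iff) auto
  also have "\<dots> = real (Suc n) * (2 * ln 2)"
    using ln_realpow[of "2::real" 2] by (simp add: ln_realpow del: power_Suc)
  also have "\<dots> \<le> real (Suc n) * 2"
    using ln_2_less_1 by (intro mult_left_mono) auto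
  finally have "ln (exp 1 + 1 / \<tau>) \<le> 2 * real (Suc n)" by simp
  moreover have "ln (exp 1 + 1 / \<tau>) \<ge> 1" using pos by (intro log_ge_one) auto
  ultimately have "(2 * real (Suc n)) powr (-q) \<le> ln (exp 1 + 1 / \<tau>) powr (-q)"
    using assms by (intro powr_mono2') auto
  moreover have "2 / 4 ^ n * (\<epsilon> * \<bar>w\<bar>) \<le> \<tau>"
    unfolding \<tau>_def using c by (intro mult_left_mono) auto
  ultimately show ?thesis
    unfolding \<tau> log_phi_pos[OF pos] using pos by (intro mult_mono) auto
qed

lemma grid_variation_lower_bound:
  assumes g: "constructed g"
    and f: "\<And>z. f z = z + of_real \<epsilon> * (\<Sum>m. g (4 ^ m * z) / 4 ^ m)"
    and "q \<ge> 0" "\<epsilon> > 0"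
  shows "phi_variation_sum (log_phi q) f 0 8 (4 ^ Suc n) (\<lambda>j. real j / 4 ^ Suc n)
    \<ge> \<epsilon> * (sqrt (Suc n) * (2 * real (Suc n)) powr (-q))"
proof -
  have P: "partition_point 0 8 (\<lambda>j. real j / 4 ^ Suc n) i = of_real (2 * real i / 4 ^ n)" for i
    by (simp add: partition_point_def)
  have "\<epsilon> * (sqrt (Suc n) * (2 * real (Suc n)) powr (-q))
      = 2 / 4 ^ n * \<epsilon> * (2 * real (Suc n)) powr (-q) * (4 ^ Suc n * sqrt (Suc n) / 8)"
    by simp
  also have "\<dots> \<le> 2 / 4 ^ n * \<epsilon> * (2 * real (Suc n)) powr (-q) * (\<Sum>j<4 ^ Suc n. \<bar>walk (Suc n) j\<bar>)"
    using assms by (intro mult_left_mono sum_abs_walk) auto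
  also have "\<dots> = (\<Sum>j<4 ^ Suc n. 2 / 4 ^ n * (\<epsilon> * \<bar>walk (Suc n) j\<bar>) * (2 * real (Suc n)) powr (-q))"
    unfolding sum_distrib_left by (intro sum.cong refl) (simp add: mult_ac)
  also have "\<dots> \<le> (\<Sum>j<4 ^ Suc n. log_phi q (cmod (of_real (2 / 4 ^ n) * Complex 1 (\<epsilon> * walk (Suc n) j))))"
    using assms by (intro sum_mono log_phi_grid_increment)
  also have "\<dots> = phi_variation_sum (log_phi q) f 0 8 (4 ^ Suc n) (\<lambda>j. real j / 4 ^ Suc n)"
    unfolding phi_variation_sum_def P grid_increment[OF g f, symmetric]
    by (rule sum.reindex_bij_witness[of _ "\<lambda>j. j - 1" Suc]) auto
  finally show ?thesis .
qed

theorem mainTheorem5: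
  fixes g f :: "complex \<Rightarrow> complex" and L \<epsilon> q :: real
  assumes "constructed g"
    and "L = lipschitz_constant g"
    and "0 < \<epsilon>" and "\<epsilon> < 1 / (2 * L)"
    and "\<And>z. f z = z + of_real \<epsilon> * (\<Sum>m. g (4 ^ m * z) / 4 ^ m)"
    and "0 \<le> q" and "q < 1 / 2"
  shows "\<not> finite_phi_variation_on_lines (log_phi q) UNIV f"
proof
  assume "finite_phi_variation_on_lines (log_phi q) UNIV f"
  then have "finite_phi_variation_on_segment (log_phi q) f 0 8"
    unfolding finite_phi_variation_on_lines_def by simp
  then obtain B where B: "phi_variation_sum (log_phi q) f 0 8 N t \<le> B"
    if "unit_partition N t" for N t
    unfolding finite_phi_variation_on_segment_def bdd_above_def by blast
  have part: "unit_partition (4 ^ Suc n) (\<lambda>j. real j / 4 ^ Suc n)" for n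
    by (auto simp: unit_partition_def divide_strict_right_mono)
  have bound: "\<epsilon> * (sqrt (Suc n) * (2 * real (Suc n)) powr (-q)) \<le> B" for n
    using grid_variation_lower_bound[OF assms(1) assms(5) assms(6) assms(3), of n] B[OF part, of n]
    by linarith
  have "filterlim (\<lambda>n. \<epsilon> * (sqrt (Suc n) * (2 * real (Suc n)) powr (-q))) at_top sequentially"
    using assms(3,6,7) by real_asymp
  then have "eventually (\<lambda>n. B < \<epsilon> * (sqrt (Suc n) * (2 * real (Suc n)) powr (-q))) sequentially"
    by (simp add: filterlim_at_top_dense)
  then show False using bound by (auto simp: eventually_sequentially not_less[symmetric])
qed

end
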